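(* Let $H$ be a graph. If for some odd integer $n\ge 3$ there exists a graph homomorphism $f: C_n \rightarrow H$ such that $\sigma_2(f) = 0$ in the group $\mathcal{G}_2(H)$, then $\mathrm{ind}(\mathrm{Hom}(K_2,H)) \geq 2$.
   Context: Graphs are finite and undirected. For a graph $H$, $A(H)$ is its set of arcs: each edge $[u,v]$ gives the two arcs $(u,v)$ and $(v,u)$. Let $\mathcal{F}_2(A(H))$ be the elementary abelian $2$-group (vector space over $\mathbb{Z}_2$, written additively) with basis $A(H)$, and let $\mathcal{G}_2(H)$ be its quotient by the subgroup generated by all elements $(a,b)+(c,b)+(c,d)+(a,d)$, where $a,b,c,d$ ranges over the 4-cycles of $H$ (vertices with $[a,b],[b,c],[c,d],[d,a]$ edges). $C_n$ is the cycle with vertex set $\mathbb{Z}_n$ and edges $[i,i+1]$. For odd $n$ and a homomorphism $f:C_n\to H$, $\sigma_2(f)=\sum_{i=0}^{n-1}\big[(f(2i),f(2i+1))+(f(2i+2),f(2i+1))\big]\in\mathcal{G}_2(H)$, indices modulo $n$. The hom-complex $\mathrm{Hom}(K_2,H)$ is the poset of pairs $(A,B)$ of nonempty subsets of $V(H)$ such that every vertex of $A$ is adjacent to every vertex of $B$, ordered by coordinatewise inclusion, with the fixed-point-free involution $-(A,B)=(B,A)$; it is viewed as a $\mathbb{Z}_2$-space via the geometric realization of its order complex, with the induced involution. For a $\mathbb{Z}_2$-space $X$, $\mathrm{ind}(X)$ is the smallest $k$ such that there is a continuous map $X\to S^k$ commuting with the involutions, $S^k$ being the unit sphere with the antipodal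 map. *)

theory Defs
  imports
    "HOL-Analysis.Analysis"
    "HOL-Algebra.Generated_Groups"
    "HOL-Library.Poly_Mapping"
    "HOL-Library.Z2"
    "HOL-Library.Product_Order"
    "HOL-Library.Extended_Nat"
    "Graph_Theory.Pair_Digraph"
begin

text \<open>
  A finite undirected graph is a \<^locale>\<open>pair_pseudo_graph\<close>: a finite vertex set with a
  symmetric set of arcs, so that \<^const>\<open>parcs\<close> is the arc set \<open>A(H)\<close>. Loops are allowed.
\<close>

definition graph_hom ::
    "'a pair_pre_digraph \<Rightarrow> 'b pair_pre_digraph \<Rightarrow> ('a \<Rightarrow> 'b) set" where
  "graph_hom G H =
     {f. f ` pverts G \<subseteq> pverts H \<and> (\<forall>u v. (u, v) \<in> parcs G \<longrightarrow> (f u, f v) \<in> parcs H)}"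

definition cycle_graph :: "nat \<Rightarrow> nat pair_pre_digraph" where
  "cycle_graph n =
     \<lparr>pverts = {..<n},
      parcs = {(i, j). i < n \<and> j < n \<and> (j = (i + 1) mod n \<or> i = (j + 1) mod n)}\<rparr>"

definition free_Z2_group :: "'b set \<Rightarrow> ('b \<Rightarrow>\<^sub>0 bit) monoid" where
  "free_Z2_group S =
     \<lparr>carrier = {x. Poly_Mapping.keys x \<subseteq> S}, monoid.mult = (+), one = 0\<rparr>"

abbreviation basis_elt :: "'b \<Rightarrow> 'b \<Rightarrow>\<^sub>0 bit" where
  "basis_elt b \<equiv> Poly_Mapping.single b 1"

text \<open>
  The vertices need not be distinct; if \<open>a = c\<close> or \<open>b = d\<close> the
  element below is 0.
\<close>

definition four_cycle_relators :: "'a pair_pre_digraph \<Rightarrow> ('a \<times> 'a \<Rightarrow>\<^sub>0 bit) set" where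
  "four_cycle_relators H =
     {basis_elt (a, b) + basis_elt (c, b) + basis_elt (c, d) + basis_elt (a, d) | a b c d.
        (a, b) \<in> parcs H \<and> (b, c) \<in> parcs H \<and> (c, d) \<in> parcs H \<and> (d, a) \<in> parcs H}"

definition relation_subgroup :: "'a pair_pre_digraph \<Rightarrow> ('a \<times> 'a \<Rightarrow>\<^sub>0 bit) set" where
  "relation_subgroup H = generate (free_Z2_group (parcs H)) (four_cycle_relators H)"

definition G2 :: "'a pair_pre_digraph \<Rightarrow> ('a \<times> 'a \<Rightarrow>\<^sub>0 bit) set monoid" where
  "G2 H = free_Z2_group (parcs H) Mod relation_subgroup H"

definition sigma2 ::
    "'a pair_pre_digraph \<Rightarrow> nat \<Rightarrow> (nat \<Rightarrow> 'a) \<Rightarrow> ('a \<times> 'a \<Rightarrow>\<^sub>0 bit) set" where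
  "sigma2 H n f =
     relation_subgroup H #>\<^bsub>free_Z2_group (parcs H)\<^esub>
       (\<Sum>i<n. basis_elt (f (2 * i mod n), f ((2 * i + 1) mod n))
            + basis_elt (f ((2 * i + 2) mod n), f ((2 * i + 1) mod n)))"

text \<open>
  The partial order on pairs of sets is the coordinatewise one of
  \<^theory>\<open>HOL-Library.Product_Order\<close>.
\<close>

definition Hom_K2 :: "'a pair_pre_digraph \<Rightarrow> ('a set \<times> 'a set) set" where
  "Hom_K2 H =
     {(A, B). A \<noteq> {} \<and> B \<noteq> {} \<and> A \<subseteq> pverts H \<and> B \<subseteq> pverts H \<and> A \<times> B \<subseteq> parcs H}"

definition order_complex :: "'p::order set \<Rightarrow> 'p set set" where
  "order_complex P =
     {C. C \<noteq> {} \<and> finite C \<and> C \<subseteq> P \<and> Complete_Partial_Order.chain (\<le>) C}"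

text \<open>
  Points are given by their barycentric coordinates. The product topology is the usual topology
  of the realization only for complexes with finitely many vertices.
\<close>

definition geometric_realization :: "'p set set \<Rightarrow> ('p \<Rightarrow> real) topology" where
  "geometric_realization K =
     subtopology (powertop_real UNIV)
       {x. (\<forall>p. 0 \<le> x p) \<and> {p. x p \<noteq> 0} \<in> K \<and> (\<Sum>p | x p \<noteq> 0. x p) = 1}"

text \<open>
  The simplicial map induced by an involution \<open>\<phi>\<close> of the vertices sends the vertex
  \<open>p\<close> to \<open>\<phi> p\<close>; in barycentric coordinates it is precomposition with
  \<open>\<phi>\<close>, the inverse of \<open>\<phi>\<close>.
\<close>

definition induced_involution :: "('p \<Rightarrow> 'p) \<Rightarrow> ('p \<Rightarrow> real) \<Rightarrow> ('p \<Rightarrow> real)" where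
  "induced_involution \<phi> x = x \<circ> \<phi>"

text \<open>The value is \<open>\<infinity>\<close> if there is no equivariant map to any sphere.\<close>

definition Z2_index :: "'x topology \<Rightarrow> ('x \<Rightarrow> 'x) \<Rightarrow> enat" where
  "Z2_index T \<tau> =
     Inf {enat k | k. \<exists>g. continuous_map T (nsphere k) g \<and>
                         (\<forall>x\<in>topspace T. g (\<tau> x) = (\<lambda>i. - g x i))}"

definition ind_Hom_K2 :: "'a pair_pre_digraph \<Rightarrow> enat" where
  "ind_Hom_K2 H =
     Z2_index (geometric_realization (order_complex (Hom_K2 H))) (induced_involution prod.swap)"

end

theory Submission
  imports Defs
begin

text \<open>
  An equivariant map to \<open>S\<^sup>0\<close> or \<open>S\<^sup>1\<close> is an odd map \<open>G\<close> to the punctured plane. The change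
  \<open>\<delta> p q\<close> of a continuous logarithm of \<open>G\<close> along the edge from \<open>p\<close> to \<open>q\<close> is a cocycle invariant under
  the involution. Write \<open>N v\<close> for the vertex (neighbours of \<open>v\<close>, \<open>{v}\<close>) of the complex.
  Going from \<open>- N u\<close> to \<open>N v\<close> through the vertex \<open>({u}, {v})\<close> changes the logarithm by an antisymmetric
  quantity that equals \<open>\<pi>\<i> + ln G(N v) - ln G(N u)\<close> up to an integer multiple \<open>k u v\<close> of
  \<open>2\<pi>\<i>\<close>. Antisymmetry gives \<open>k u v + k v u = - 1\<close>, and for a 4-cycle \<open>a, b, c, d\<close> the cocycle is a
  coboundary below the vertex \<open>({a, c}, {b, d})\<close>, so that \<open>k a b - k c b + k c d - k a d = 0\<close>. Hence
  \<open>k\<close> modulo 2 is a linear functional on \<open>G2 H\<close>, and its value on \<open>\<sigma>\<^sub>2(f)\<close> is \<open>n\<close> modulo 2, which is 1.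
\<close>

section \<open>Continuous logarithms along a path\<close>

definition log_change :: "(real \<Rightarrow> complex) \<Rightarrow> complex \<Rightarrow> bool" where
  "log_change h d \<longleftrightarrow>
     (\<exists>l. continuous_on {0..1} l \<and> (\<forall>t\<in>{0..1}. h t = exp (l t)) \<and> d = l 1 - l 0)"

text \<open>Two logarithms of the same function differ at each point by an integer multiple of
  \<open>2 * pi * \<i>\<close>. Their difference is thus continuous with values at least
  \<open>2 * pi\<close> apart, hence constant on the connected interval.\<close>

lemma log_change_unique:
  assumes "log_change h d" "log_change h e"
  shows "d = e"
proof -
  obtain l m where l: "continuous_on {0..1} l" "\<And>t. t \<in> {0..1} \<Longrightarrow> h t = exp (l t)" "d = l 1 - l 0"
    and m: "continuous_on {0..1} m" "\<And>t. t \<in> {0..1} \<Longrightarrow> h t = exp (m t)" "e = m 1 - m 0"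
    using assms unfolding log_change_def by metis
  have "(\<lambda>t. l t - m t) constant_on {0..1}"
  proof (rule continuous_discrete_range_constant)
    show "continuous_on {0..1} (\<lambda>t. l t - m t)"
      by (intro continuous_intros l m)
    fix s :: real
    assume s: "s \<in> {0..1}"
    have "2 * pi \<le> norm ((l t - m t) - (l s - m s))"
      if t: "t \<in> {0..1}" and ne: "l t - m t \<noteq> l s - m s" for t
    proof -
      obtain j where j: "l t = m t + (of_int (2 * j) * pi) * \<i>"
        using l(2) m(2) t exp_eq by metis
      obtain k where k: "l s = m s + (of_int (2 * k) * pi) * \<i>"
        using l(2) m(2) s exp_eq by metis
      have eq: "(l t - m t) - (l s - m s) = complex_of_real (2 * pi * of_int (j - k)) * \<i>"
        by (simp add: j k algebra_simps)
      have "j \<noteq> k"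
        using ne j k by auto
      then have "1 \<le> \<bar>real_of_int (j - k)\<bar>"
        by linarith
      then show ?thesis
        unfolding eq norm_mult norm_of_real by (simp add: abs_mult)
    qed
    then show "\<exists>e>0. \<forall>t. t \<in> {0..1} \<and> l t - m t \<noteq> l s - m s
        \<longrightarrow> e \<le> norm ((l t - m t) - (l s - m s))"
      by (intro exI[of _ "2 * pi"]) auto
  qed auto
  then have "l 1 - m 1 = l 0 - m 0"
    unfolding constant_on_def by (metis atLeastAtMost_iff order_refl zero_le_one)
  then show ?thesis
    unfolding l(3) m(3) by (simp add: algebra_simps)
qed

lemma log_change_exp:
  assumes "log_change h d"
  shows "exp d = h 1 / h 0"
  using assms by (auto simp: log_change_def exp_diff)

text \<open>Since -1 is the exponential of \<open>\<i> * pi\<close>, a constant shift of the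
  logarithm absorbs the sign. This turns oddness of a map into invariance of its logarithmic
  increments.\<close>

lemma log_change_uminus:
  assumes "log_change h d"
  shows "log_change (\<lambda>t. - h t) d"
proof -
  obtain l where l: "continuous_on {0..1} l" "\<And>t. t \<in> {0..1} \<Longrightarrow> h t = exp (l t)" "d = l 1 - l 0"
    using assms unfolding log_change_def by metis
  show ?thesis
    unfolding log_change_def
    by (rule exI[of _ "\<lambda>t. l t + \<i> * pi"]) (auto intro!: continuous_intros l simp: exp_add l)
qed

section \<open>Segments and triangles in the realization of an order complex\<close>

text \<open>A sum of indicator terms, rather than a case distinction, keeps the formula right when
  the two ends coincide: their weights then add up to 1.\<close>

definition segment_point :: "'p \<Rightarrow> 'p \<Rightarrow> real \<Rightarrow> 'p \<Rightarrow> real" where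
  "segment_point p q t = (\<lambda>x. (1 - t) * of_bool (x = p) + t * of_bool (x = q))"

definition triangle_point :: "'p \<Rightarrow> 'p \<Rightarrow> 'p \<Rightarrow> real \<times> real \<Rightarrow> 'p \<Rightarrow> real" where
  "triangle_point p q r z =
     (\<lambda>x. (1 - fst z - snd z) * of_bool (x = p) + fst z * of_bool (x = q) + snd z * of_bool (x = r))"

definition std_triangle :: "(real \<times> real) set" where
  "std_triangle = {z. 0 \<le> fst z \<and> 0 \<le> snd z \<and> fst z + snd z \<le> 1}"

lemma convex_std_triangle: "convex std_triangle"
proof -
  have "std_triangle = {z. (- 1, 0) \<bullet> z \<le> 0} \<inter> {z. (0, - 1) \<bullet> z \<le> 0} \<inter> {z. (1, 1) \<bullet> z \<le> 1}"
    by (auto simp: std_triangle_def)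
  also have "convex \<dots>"
    by (intro convex_Int convex_halfspace_le)
  finally show ?thesis .
qed

text \<open>The support is a nonempty subset of the chain \<open>{p, q, r}\<close>. Degenerate
  triangles are included; they provide the segments later.\<close>

lemma triangle_point_in_realization:
  assumes "p \<in> P" "q \<in> P" "r \<in> P" "p \<le> q" "q \<le> r" "z \<in> std_triangle"
  shows "triangle_point p q r z \<in> topspace (geometric_realization (order_complex P))"
proof -
  let ?x = "triangle_point p q r z"
  have nonneg: "0 \<le> ?x y" for y
    using assms(6) by (auto simp: triangle_point_def std_triangle_def)
  have supp: "{y. ?x y \<noteq> 0} \<subseteq> {p, q, r}"
    by (auto simp: triangle_point_def)
  have "(\<Sum>y | ?x y \<noteq> 0. ?x y) = (\<Sum>y\<in>{p, q, r}. ?x y)"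
    by (rule sum.mono_neutral_left) (use supp in auto)
  also have "\<dots> = 1"
  proof -
    \<comment> \<open>The total is computed one indicator at a time, because
      \<open>{p, q, r}\<close> may have fewer than three elements.\<close>
    have "(\<Sum>y\<in>{p, q, r}. c * of_bool (y = a)) = c" if "a \<in> {p, q, r}" for a and c :: real
      using that sum.delta[of "{p, q, r}" a "\<lambda>_. c"] by (simp add: of_bool_def if_distrib cong: if_cong)
    then show ?thesis
      unfolding triangle_point_def sum.distrib by simp
  qed
  finally have sum1: "(\<Sum>y | ?x y \<noteq> 0. ?x y) = 1" .
  have "p \<le> r"
    using assms by (meson order_trans)
  then have "Complete_Partial_Order.chain (\<le>) {p, q, r}"
    using assms by (auto simp: Complete_Partial_Order.chain_def)
  moreover have "{y. ?x y \<noteq> 0} \<noteq> {}"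
    using sum1 by force
  ultimately have "{y. ?x y \<noteq> 0} \<in> order_complex P"
    unfolding order_complex_def
    using supp assms(1-3) by (auto intro: finite_subset Complete_Partial_Order.chain_subset)
  then show ?thesis
    using nonneg sum1 by (simp add: geometric_realization_def)
qed

lemma continuous_on_triangle_point:
  assumes G: "continuous_map (geometric_realization (order_complex P)) euclidean G"
    and "p \<in> P" "q \<in> P" "r \<in> P" "p \<le> q" "q \<le> r"
  shows "continuous_on std_triangle (\<lambda>z. G (triangle_point p q r z))"
proof -
  have "continuous_map (top_of_set std_triangle) (powertop_real UNIV) (triangle_point p q r)"
    unfolding continuous_map_componentwise_UNIV triangle_point_def
    by (auto intro!: continuous_intros)
  then have "continuous_map (top_of_set std_triangle)
      (geometric_realization (order_complex P)) (triangle_point p q r)"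
    using triangle_point_in_realization[OF assms(2-6)]
    unfolding geometric_realization_def
    by (auto simp: continuous_map_in_subtopology)
  from continuous_map_compose[OF this G] show ?thesis
    by (simp add: o_def)
qed

text \<open>The triangle is contractible, so one logarithm \<open>L\<close> exists on all of it. The
  increments along the three edges are differences of the values of \<open>L\<close> at the corners
  and therefore add up.\<close>

lemma triangle_log_change:
  fixes G :: "('p::order \<Rightarrow> real) \<Rightarrow> complex"
  assumes G: "continuous_map (geometric_realization (order_complex P)) euclidean G"
    and nz: "\<And>x. x \<in> topspace (geometric_realization (order_complex P)) \<Longrightarrow> G x \<noteq> 0"
    and P: "p \<in> P" "q \<in> P" "r \<in> P" "p \<le> q" "q \<le> r"
  obtains d e where "log_change (G \<circ> segment_point p q) d" "log_change (G \<circ> segment_point q r) e"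
    "log_change (G \<circ> segment_point p r) (d + e)"
proof -
  obtain L where L: "continuous_on std_triangle L"
      "\<And>z. z \<in> std_triangle \<Longrightarrow> G (triangle_point p q r z) = exp (L z)"
    using continuous_logarithm_on_contractible
      [OF continuous_on_triangle_point[OF G P] convex_imp_contractible[OF convex_std_triangle]]
      nz[OF triangle_point_in_realization[OF P]] by metis
  have edge: "log_change (G \<circ> segment_point a b) (L (e 1) - L (e 0))"
    if e: "continuous_on {0..1} e" "e ` {0..1} \<subseteq> std_triangle"
      and seg: "\<And>t. segment_point a b t = triangle_point p q r (e t)" for a b e
    unfolding log_change_def
    using continuous_on_compose2[OF L(1) e] L(2) e(2)
    by (intro exI[of _ "\<lambda>t. L (e t)"]) (auto simp: seg image_subset_iff)
  \<comment> \<open>The corners \<open>(0, 0)\<close>, \<open>(1, 0)\<close> and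
    \<open>(0, 1)\<close> correspond to \<open>p\<close>, \<open>q\<close> and
    \<open>r\<close>.\<close>
  have "log_change (G \<circ> segment_point p q) (L (1, 0) - L (0, 0))"
    by (rule edge[of "\<lambda>t. (t, 0)", simplified])
      (auto intro!: continuous_intros simp: std_triangle_def segment_point_def triangle_point_def)
  moreover have "log_change (G \<circ> segment_point q r) (L (0, 1) - L (1, 0))"
    by (rule edge[of "\<lambda>t. (1 - t, t)", simplified])
      (auto intro!: continuous_intros simp: std_triangle_def segment_point_def triangle_point_def)
  moreover have "log_change (G \<circ> segment_point p r) (L (0, 1) - L (0, 0))"
    by (rule edge[of "\<lambda>t. (0, t)", simplified])
      (auto intro!: continuous_intros simp: std_triangle_def segment_point_def triangle_point_def)
  ultimately show thesis
    by (intro that[of "L (1, 0) - L (0, 0)" "L (0, 1) - L (1, 0)"]) auto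
qed

section \<open>Odd maps to the punctured plane and their cocycles\<close>

definition odd_nonvanishing_map :: "'x topology \<Rightarrow> ('x \<Rightarrow> 'x) \<Rightarrow> ('x \<Rightarrow> complex) \<Rightarrow> bool" where
  "odd_nonvanishing_map T \<tau> G \<longleftrightarrow>
     continuous_map T euclidean G \<and> (\<forall>x\<in>topspace T. G x \<noteq> 0 \<and> G (\<tau> x) = - G x)"

text \<open>This extracts the combinatorial data of \<open>G\<close>: its values \<open>g\<close> at
  the vertices and the logarithmic increments \<delta> along the edges. The argument about
  \<open>Hom_K2 H\<close> works with these alone.\<close>

lemma equivariant_cocycle:
  fixes G :: "('p::order \<Rightarrow> real) \<Rightarrow> complex" and \<phi> :: "'p \<Rightarrow> 'p"
  assumes odd_map: "odd_nonvanishing_map (geometric_realization (order_complex P)) (induced_involution \<phi>) G"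
    and inv: "\<And>p. \<phi> (\<phi> p) = p"
  obtains \<delta> g where
    "\<And>p q r. p \<in> P \<Longrightarrow> q \<in> P \<Longrightarrow> r \<in> P \<Longrightarrow> p \<le> q \<Longrightarrow> q \<le> r \<Longrightarrow> \<delta> p r = \<delta> p q + \<delta> q r"
    "\<And>p q. p \<in> P \<Longrightarrow> q \<in> P \<Longrightarrow> p \<le> q \<Longrightarrow> exp (\<delta> p q) = g q / g p"
    "\<And>p q. p \<in> P \<Longrightarrow> q \<in> P \<Longrightarrow> p \<le> q \<Longrightarrow> \<delta> (\<phi> p) (\<phi> q) = \<delta> p q"
    "\<And>p. p \<in> P \<Longrightarrow> g p \<noteq> (0::complex)"
    "\<And>p. p \<in> P \<Longrightarrow> g (\<phi> p) = - g p"
proof -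
  have G: "continuous_map (geometric_realization (order_complex P)) euclidean G"
    and nz: "\<And>x. x \<in> topspace (geometric_realization (order_complex P)) \<Longrightarrow> G x \<noteq> 0"
    and equiv: "\<And>x. x \<in> topspace (geometric_realization (order_complex P)) \<Longrightarrow>
      G (induced_involution \<phi> x) = - G x"
    using odd_map by (auto simp: odd_nonvanishing_map_def)
  define g where "g p = G (\<lambda>x. of_bool (x = p))" for p
  define \<delta> where "\<delta> p q = (THE d. log_change (G \<circ> segment_point p q) d)" for p q
  have \<delta>: "\<delta> p q = d" if "log_change (G \<circ> segment_point p q) d" for p q d
    unfolding \<delta>_def using that log_change_unique by blast
  have seg: "segment_point p q t \<in> topspace (geometric_realization (order_complex P))"
    if "p \<in> P" "q \<in> P" "p \<le> q" "t \<in> {0..1}" for p q t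
  proof -
    have "segment_point p q t = triangle_point p q q (t, 0)"
      by (simp add: segment_point_def triangle_point_def)
    then show ?thesis
      using triangle_point_in_realization[of p P q q "(t, 0)"] that by (simp add: std_triangle_def)
  qed
  \<comment> \<open>The degenerate triangle \<open>p\<close>, \<open>q\<close>, \<open>q\<close>
    supplies a logarithm along the edge, so the description defining \<delta> has a value
    here.\<close>
  have change: "log_change (G \<circ> segment_point p q) (\<delta> p q)" if "p \<in> P" "q \<in> P" "p \<le> q" for p q
    using triangle_log_change[OF G nz, of p q q] that \<delta> by (metis order_refl)
  show thesis
  proof
    fix p q r assume "p \<in> P" "q \<in> P" "r \<in> P" "p \<le> q" "q \<le> r"
    then show "\<delta> p r = \<delta> p q + \<delta> q r"
      using triangle_log_change[OF G nz, of p q r] \<delta> by metis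
  next
    fix p q assume pq: "p \<in> P" "q \<in> P" "p \<le> q"
    show "exp (\<delta> p q) = g q / g p"
      using log_change_exp[OF change[OF pq]] by (simp add: g_def segment_point_def)
    obtain l where l: "continuous_on {0..1} l"
        "\<And>t. t \<in> {0..1} \<Longrightarrow> - G (segment_point p q t) = exp (l t)" "\<delta> p q = l 1 - l 0"
      using log_change_uminus[OF change[OF pq]] unfolding log_change_def by auto
    \<comment> \<open>Precomposition with \<phi> moves the weight at \<open>p\<close> to
      \<open>\<phi> p\<close>, as \<phi> is its own inverse. By oddness the logarithm
      \<open>l\<close> of the negated map then serves the image segment.\<close>
    have "segment_point (\<phi> p) (\<phi> q) t = induced_involution \<phi> (segment_point p q t)" for t
      using inv by (auto simp: segment_point_def induced_involution_def fun_eq_iff) (metis inv)+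
    then have "log_change (G \<circ> segment_point (\<phi> p) (\<phi> q)) (\<delta> p q)"
      unfolding log_change_def using l equiv[OF seg[OF pq]] by (intro exI[of _ l]) auto
    then show "\<delta> (\<phi> p) (\<phi> q) = \<delta> p q"
      by (rule \<delta>)
  next
    fix p assume p: "p \<in> P"
    have vertex: "(\<lambda>x. of_bool (x = p)) \<in> topspace (geometric_realization (order_complex P))"
      using seg[of p p 0] p by (simp add: segment_point_def)
    then show "g p \<noteq> 0"
      using nz by (simp add: g_def)
    have "(\<lambda>x. of_bool (x = \<phi> p)) = induced_involution \<phi> (\<lambda>x. of_bool (x = p) :: real)"
      by (auto simp: induced_involution_def fun_eq_iff) (metis inv)+
    then show "g (\<phi> p) = - g p"
      using equiv[OF vertex] by (simp add: g_def)
  qed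
qed

lemma Z2_index_less_2_odd_map:
  fixes T :: "'x topology"
  assumes "\<not> 2 \<le> Z2_index T \<tau>"
  obtains G :: "'x \<Rightarrow> complex" where "odd_nonvanishing_map T \<tau> G"
proof -
  have "Z2_index T \<tau> < 2"
    using assms by simp
  then obtain k g where "enat k < 2" and g: "continuous_map T (nsphere k) g"
    and equiv: "\<And>x. x \<in> topspace T \<Longrightarrow> g (\<tau> x) = (\<lambda>i. - g x i)"
    unfolding Z2_index_def Inf_less_iff by auto
  then have k: "k = 0 \<or> k = 1"
    by (auto simp: numeral_eq_enat)
  define G where "G x = Complex (g x 0) (g x 1)" for x
  have comp: "continuous_map T euclideanreal (\<lambda>x. g x i)" for i
    using continuous_map_compose[OF g continuous_map_nsphere_projection[of k i]] by (simp add: o_def)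
  have "odd_nonvanishing_map T \<tau> G"
    unfolding odd_nonvanishing_map_def
  proof (intro conjI ballI)
    have "continuous_map T euclidean (\<lambda>x. complex_of_real (g x 0) + \<i> * complex_of_real (g x 1))"
      by (intro continuous_intros continuous_map_compose[OF comp, unfolded o_def])
        (auto intro!: continuous_intros)
    then show "continuous_map T euclidean G"
      by (simp add: G_def[abs_def] Complex_eq)
  next
    fix x assume x: "x \<in> topspace T"
    have "g x \<in> topspace (nsphere k)"
      using g x by (auto simp: continuous_map_def)
    then have "(\<Sum>i\<le>k. (g x i)\<^sup>2) = 1"
      by (simp add: nsphere)
    \<comment> \<open>For \<open>k = 0\<close> the real part alone has square 1; for
      \<open>k = 1\<close> the squares of both parts sum to 1.\<close>
    then show "G x \<noteq> 0"
      using k by (auto simp: G_def complex_eq_iff)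
    show "G (\<tau> x) = - G x"
      by (simp add: G_def equiv[OF x] complex_eq_iff)
  qed
  then show thesis
    by (rule that)
qed

section \<open>The parity of the arcs of \<open>H\<close>\<close>

text \<open>The parity \<kappa> is the reduction modulo 2 of the integers \<open>k u v\<close>. Over
  \<int> the two identities carry signs; modulo 2 they take the shape of an arc reversal rule and of
  the relators.\<close>

lemma Hom_K2_arc_parity:
  fixes H :: "'a pair_pre_digraph" and G :: "('a set \<times> 'a set \<Rightarrow> real) \<Rightarrow> complex"
  assumes H: "pair_sym_digraph H"
    and G: "odd_nonvanishing_map (geometric_realization (order_complex (Hom_K2 H)))
      (induced_involution prod.swap) G"
  obtains \<kappa> :: "'a \<times> 'a \<Rightarrow> bit" where
    "\<And>u v. (u, v) \<in> parcs H \<Longrightarrow> \<kappa> (u, v) + \<kappa> (v, u) = 1"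
    "\<And>a b c d. (a, b) \<in> parcs H \<Longrightarrow> (b, c) \<in> parcs H \<Longrightarrow> (c, d) \<in> parcs H \<Longrightarrow>
      (d, a) \<in> parcs H \<Longrightarrow> \<kappa> (a, b) + \<kappa> (c, b) + \<kappa> (c, d) + \<kappa> (a, d) = 0"
proof -
  interpret pair_sym_digraph H by (rule H)
  have sym: "(v, u) \<in> parcs H" if "(u, v) \<in> parcs H" for u v
    using that pair_sym_arcs by (auto simp: symmetric_def sym_def)
  define P where "P = Hom_K2 H"
  obtain \<delta> g where cocycle: "\<And>p q r. p \<in> P \<Longrightarrow> q \<in> P \<Longrightarrow> r \<in> P \<Longrightarrow> p \<le> q \<Longrightarrow> q \<le> r \<Longrightarrow>
      \<delta> p r = \<delta> p q + \<delta> q r"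
    and exp_\<delta>: "\<And>p q. p \<in> P \<Longrightarrow> q \<in> P \<Longrightarrow> p \<le> q \<Longrightarrow> exp (\<delta> p q) = g q / g p"
    and \<delta>_swap: "\<And>p q. p \<in> P \<Longrightarrow> q \<in> P \<Longrightarrow> p \<le> q \<Longrightarrow> \<delta> (prod.swap p) (prod.swap q) = \<delta> p q"
    and g_nz: "\<And>p. p \<in> P \<Longrightarrow> g p \<noteq> (0::complex)"
    and g_swap: "\<And>p. p \<in> P \<Longrightarrow> g (prod.swap p) = - g p"
    apply (rule equivariant_cocycle[OF G swap_swap, folded P_def])
    subgoal premises prems by (rule prems(1)) (fact prems(2-))+
    done
  \<comment> \<open>For \<open>v\<close> with a neighbour, \<open>N v\<close> is the largest element
    of \<open>P\<close> with second component \<open>{v}\<close>. It lies above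
    \<open>({u}, {v})\<close> for every neighbour \<open>u\<close>, yet depends on \<open>v\<close>
    only.\<close>
  define N where "N v = ({u. (u, v) \<in> parcs H}, {v})" for v
  have arc_P: "({u}, {v}) \<in> P" if "(u, v) \<in> parcs H" for u v
    using that by (auto simp: P_def Hom_K2_def in_arcsD1 in_arcsD2)
  have N_P: "N v \<in> P" if "(u, v) \<in> parcs H" for u v
    using that by (auto simp: P_def N_def Hom_K2_def in_arcsD1 in_arcsD2)
  have arc_N: "({u}, {v}) \<le> N v" if "(u, v) \<in> parcs H" for u v
    using that by (auto simp: N_def less_eq_prod_def)
  define \<psi> where "\<psi> u v = \<delta> ({u}, {v}) (N v)" for u v
  \<comment> \<open>The path descends from the swap of \<open>N u\<close> to
    \<open>({u}, {v})\<close> and ascends to \<open>N v\<close>. By invariance the descent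
    contributes \<open>- \<psi> v u\<close>.\<close>
  define \<phi> where "\<phi> u v = \<psi> u v - \<psi> v u" for u v
  \<comment> \<open>Any logarithm of \<open>g (N v)\<close> would do. It depends on \<open>v\<close>
    alone, so it cancels in the sums below.\<close>
  define \<beta> where "\<beta> v = Ln (g (N v))" for v
  have "\<exists>k::int. \<phi> u v = (\<i> * pi + \<beta> v - \<beta> u) + (of_int (2 * k) * pi) * \<i>"
    if uv: "(u, v) \<in> parcs H" for u v
  proof -
    note vu = sym[OF uv]
    have "g ({v}, {u}) = - g ({u}, {v})"
      using g_swap[OF arc_P[OF uv]] by simp
    \<comment> \<open>The values at \<open>({u}, {v})\<close> and at its swap cancel up to the sign,
      which is the source of the term \<open>\<i> * pi\<close>.\<close>
    then have "exp (\<phi> u v) = - (g (N v) / g (N u))"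
      using g_nz[OF arc_P[OF uv]] g_nz[OF N_P[OF uv]] g_nz[OF N_P[OF vu]]
      by (simp add: \<phi>_def \<psi>_def exp_diff exp_\<delta> arc_P N_P[OF uv] N_P[OF vu] arc_N uv vu field_simps)
    also have "\<dots> = exp (\<i> * pi + \<beta> v - \<beta> u)"
      using g_nz[OF N_P[OF uv]] g_nz[OF N_P[OF vu]] by (simp add: \<beta>_def exp_diff exp_add)
    finally show ?thesis
      unfolding exp_eq .
  qed
  then obtain k :: "'a \<Rightarrow> 'a \<Rightarrow> int" where
    k: "\<phi> u v = (\<i> * pi + \<beta> v - \<beta> u) + (of_int (2 * k u v) * pi) * \<i>"
    if "(u, v) \<in> parcs H" for u v
    by metis
  have bit_minus: "x - y = x + y" for x y :: bit
    by (cases x; cases y) auto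
  show thesis
  proof
    fix u v assume uv: "(u, v) \<in> parcs H"
    have "\<phi> u v + \<phi> v u = 0"
      by (simp add: \<phi>_def)
    \<comment> \<open>The \<beta> terms cancel, and the two half turns \<open>\<i> * pi\<close>
      combine to the summand 1.\<close>
    then have "complex_of_int (1 + k u v + k v u) * (2 * pi * \<i>) = 0"
      unfolding k[OF uv] k[OF sym[OF uv]] by (simp add: algebra_simps)
    then have "1 + k u v + k v u = 0"
      by (simp only: mult_eq_0_iff of_int_eq_0_iff) simp
    then have "of_int (k u v + k v u) = (of_int (- 1) :: bit)"
      by (metis add.assoc add_eq_0_iff)
    then show "(\<lambda>(u, v). of_int (k u v) :: bit) (u, v) + (\<lambda>(u, v). of_int (k u v)) (v, u) = 1"
      by simp
  next
    fix a b c d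
    assume ab: "(a, b) \<in> parcs H" and bc: "(b, c) \<in> parcs H"
      and cd: "(c, d) \<in> parcs H" and da: "(d, a) \<in> parcs H"
    \<comment> \<open>In such a difference the upper end \<open>N v\<close> may be replaced by
      \<open>({u, w}, {v, x})\<close>. Both lie above \<open>({u, w}, {v})\<close>, and the
      increment from there upwards is common to the two terms and drops out.\<close>
    have \<psi>_diff: "\<psi> u v - \<psi> w v = \<delta> ({u}, {v}) ({u, w}, {v, x}) - \<delta> ({w}, {v}) ({u, w}, {v, x})"
      if "(u, v) \<in> parcs H" "(w, v) \<in> parcs H" "(u, x) \<in> parcs H" "(w, x) \<in> parcs H" for u v w x
    proof -
      have mid: "({u, w}, {v}) \<in> P" "({u, w}, {v, x}) \<in> P"
        using that by (auto simp: P_def Hom_K2_def in_arcsD1 in_arcsD2)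
      have le: "({u}, {v}) \<le> ({u, w}, {v})" "({w}, {v}) \<le> ({u, w}, {v})"
        "({u, w}, {v}) \<le> ({u, w}, {v, x})" "({u, w}, {v}) \<le> N v"
        using that by (auto simp: N_def less_eq_prod_def)
      show ?thesis
        unfolding \<psi>_def
        using cocycle[OF arc_P[OF that(1)] mid(1) mid(2) le(1,3)]
          cocycle[OF arc_P[OF that(2)] mid(1) mid(2) le(2,3)]
          cocycle[OF arc_P[OF that(1)] mid(1) N_P[OF that(1)] le(1,4)]
          cocycle[OF arc_P[OF that(2)] mid(1) N_P[OF that(1)] le(2,4)]
        by simp
    qed
    let ?M = "({a, c}, {b, d})"
    have M: "?M \<in> P"
      using ab bc cd da sym by (auto simp: P_def Hom_K2_def in_arcsD1 in_arcsD2)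
    \<comment> \<open>By invariance the reversed arcs, which lie below the swap of
      \<open>?M\<close>, are also measured by increments up to \<open>?M\<close>.\<close>
    have swap: "\<delta> ({v}, {u}) ({b, d}, {a, c}) = \<delta> ({u}, {v}) ?M"
      if "(u, v) \<in> parcs H" "u \<in> {a, c}" "v \<in> {b, d}" for u v
      using \<delta>_swap[OF arc_P[OF that(1)] M] that by (auto simp: less_eq_prod_def)
    have "\<psi> a b - \<psi> c b = \<delta> ({a}, {b}) ?M - \<delta> ({c}, {b}) ?M"
      by (rule \<psi>_diff) (use ab bc cd da sym in auto)
    moreover have "\<psi> a d - \<psi> c d = \<delta> ({a}, {d}) ?M - \<delta> ({c}, {d}) ?M"
      using \<psi>_diff[of a d c b] ab bc cd da sym by (auto simp: insert_commute)
    moreover have "\<psi> b a - \<psi> d a = \<delta> ({a}, {b}) ?M - \<delta> ({a}, {d}) ?M"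
      using \<psi>_diff[of b a d c] ab bc cd da sym by (auto simp: swap)
    moreover have "\<psi> b c - \<psi> d c = \<delta> ({c}, {b}) ?M - \<delta> ({c}, {d}) ?M"
      using \<psi>_diff[of b c d a] ab bc cd da sym by (auto simp: swap insert_commute)
    \<comment> \<open>Expanded, the left side is the first difference minus the second, minus the
      third, plus the fourth; on the right sides every increment to \<open>?M\<close> then occurs
      with both signs.\<close>
    ultimately have "\<phi> a b - \<phi> c b + \<phi> c d - \<phi> a d = 0"
      unfolding \<phi>_def by algebra
    \<comment> \<open>The signs alternate around the cycle, so the half turns and all \<beta> terms
      cancel.\<close>
    then have "complex_of_int (k a b - k c b + k c d - k a d) * (2 * pi * \<i>) = 0"
      unfolding k[OF ab] k[OF sym[OF bc]] k[OF cd] k[OF sym[OF da]] by (simp add: algebra_simps)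
    then have "k a b - k c b + k c d - k a d = 0"
      by (simp only: mult_eq_0_iff of_int_eq_0_iff) simp
    then have "of_int (k a b - k c b + k c d - k a d) = (0 :: bit)"
      by simp
    then show "(\<lambda>(u, v). of_int (k u v) :: bit) (a, b) + (\<lambda>(u, v). of_int (k u v)) (c, b) +
        (\<lambda>(u, v). of_int (k u v)) (c, d) + (\<lambda>(u, v). of_int (k u v)) (a, d) = 0"
      by (simp add: bit_minus)
  qed
qed

section \<open>Additive maps to the two-element field and their value on an odd cycle\<close>

lemma group_free_Z2_group: "group (free_Z2_group S)"
proof (rule groupI)
  fix x y assume "x \<in> carrier (free_Z2_group S)" "y \<in> carrier (free_Z2_group S)"
  then show "x \<otimes>\<^bsub>free_Z2_group S\<^esub> y \<in> carrier (free_Z2_group S)"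
    using Poly_Mapping.keys_add[of x y] by (auto simp: free_Z2_group_def)
next
  fix x assume x: "x \<in> carrier (free_Z2_group S)"
  have "x + x = 0"
    by (rule poly_mapping_eqI) (simp add: lookup_add)
  with x show "\<exists>y\<in>carrier (free_Z2_group S). y \<otimes>\<^bsub>free_Z2_group S\<^esub> x = \<one>\<^bsub>free_Z2_group S\<^esub>"
    by (auto simp: free_Z2_group_def)
qed (auto simp: free_Z2_group_def add.assoc)

text \<open>This lets a functional that kills the relators descend to the quotient group; the proof
  is by induction on the generation of \<open>x\<close>.\<close>

lemma additive_zero_on_generate:
  fixes K :: "('b \<Rightarrow>\<^sub>0 bit) \<Rightarrow> bit"
  assumes add: "\<And>x y. K (x + y) = K x + K y"
    and R: "R \<subseteq> carrier (free_Z2_group S)" "\<And>x. x \<in> R \<Longrightarrow> K x = 0"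
    and x: "x \<in> generate (free_Z2_group S) R"
  shows "K x = 0"
proof -
  interpret group "free_Z2_group S" by (rule group_free_Z2_group)
  have K0: "K 0 = 0"
    using add[of 0 0] by simp
  show ?thesis
    using x
  proof (induction rule: generate.induct)
    case (inv h)
    have "inv\<^bsub>free_Z2_group S\<^esub> h + h = 0"
      using l_inv[of h] inv R(1) by (auto simp: free_Z2_group_def)
    then show ?case
      using add[of "inv\<^bsub>free_Z2_group S\<^esub> h" h] R(2)[OF inv] K0 by simp
  qed (use K0 R(2) add in \<open>auto simp: free_Z2_group_def\<close>)
qed

text \<open>Each reversed arc costs an extra 1, so the sum is \<open>n\<close> plus the sum of the
  forward values \<open>c j\<close> over \<open>2 * n\<close> consecutive arcs. These go round the
  cycle exactly twice and cancel modulo 2, and \<open>n\<close> is odd.\<close>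

lemma alternating_cycle_sum:
  fixes \<kappa> :: "'a \<times> 'a \<Rightarrow> bit"
  assumes "odd n" and \<kappa>: "\<And>j. \<kappa> (f (j mod n), f (Suc j mod n)) + \<kappa> (f (Suc j mod n), f (j mod n)) = 1"
  shows "(\<Sum>i<n. \<kappa> (f (2 * i mod n), f ((2 * i + 1) mod n))
                + \<kappa> (f ((2 * i + 2) mod n), f ((2 * i + 1) mod n))) = 1"
proof -
  define c where "c j = \<kappa> (f (j mod n), f (Suc j mod n))" for j
  have "\<kappa> (f ((2 * i + 2) mod n), f ((2 * i + 1) mod n)) = 1 + c (2 * i + 1)" for i
    using \<kappa>[of "2 * i + 1"] unfolding c_def
    by (cases "\<kappa> (f ((2 * i + 1) mod n), f (Suc (2 * i + 1) mod n))") auto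
  then have "(\<Sum>i<n. \<kappa> (f (2 * i mod n), f ((2 * i + 1) mod n))
                + \<kappa> (f ((2 * i + 2) mod n), f ((2 * i + 1) mod n)))
      = (\<Sum>i<n. 1 + (c (2 * i) + c (2 * i + 1)))"
    by (simp only: c_def add_ac Suc_eq_plus1)
  also have "\<dots> = of_nat n + (\<Sum>i<n. c (2 * i) + c (2 * i + 1))"
    by (simp only: sum.distrib sum_constant card_lessThan mult_1_right)
  also have "(\<Sum>i<m. c (2 * i) + c (2 * i + 1)) = (\<Sum>j<2 * m. c j)" for m
    by (induction m) (simp_all only: mult_0_right lessThan_0 sum.empty mult_Suc_right add_2_eq_Suc
        sum.lessThan_Suc add.assoc Suc_eq_plus1[symmetric])
  \<comment> \<open>Splitting into the two rounds; \<open>c\<close> has period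
    \<open>n\<close>.\<close>
  also have "(\<Sum>j<2 * n. c j) = (\<Sum>j<n. c j) + (\<Sum>j<n. c (j + n))"
    using sum.atLeastLessThan_concat[of 0 n "n + n" c] sum.shift_bounds_nat_ivl[of c 0 n n]
    by (simp only: mult_2 lessThan_atLeast0 le0 le_add2 add_0)
  also have "(\<Sum>j<n. c (j + n)) = (\<Sum>j<n. c j)"
    by (simp add: c_def flip: add_Suc)
  also have "y + y = 0" for y :: bit
    by (cases y) auto
  also have "of_nat n + 0 = (1 :: bit)"
    using \<open>odd n\<close> by (auto elim!: oddE)
  finally show ?thesis .
qed

section \<open>The functional on the group and the contradiction\<close>

theorem theorem2:
  fixes H :: "'a pair_pre_digraph"
  assumes "pair_pseudo_graph H"
    and "\<exists>n\<ge>3. odd n \<and> (\<exists>f \<in> graph_hom (cycle_graph n) H. sigma2 H n f = \<one>\<^bsub>G2 H\<^esub>)"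
  shows "ind_Hom_K2 H \<ge> 2"
proof (rule ccontr)
  assume "\<not> 2 \<le> ind_Hom_K2 H"
  interpret pair_pseudo_graph H by (rule assms(1))
  have sym: "(v, u) \<in> parcs H" if "(u, v) \<in> parcs H" for u v
    using that pair_sym_arcs by (auto simp: symmetric_def sym_def)
  obtain G :: "('a set \<times> 'a set \<Rightarrow> real) \<Rightarrow> complex" where
    G: "odd_nonvanishing_map (geometric_realization (order_complex (Hom_K2 H)))
      (induced_involution prod.swap) G"
    using \<open>\<not> 2 \<le> ind_Hom_K2 H\<close> unfolding ind_Hom_K2_def
    by (rule Z2_index_less_2_odd_map)
  obtain \<kappa> :: "'a \<times> 'a \<Rightarrow> bit" where
    \<kappa>: "\<And>u v. (u, v) \<in> parcs H \<Longrightarrow> \<kappa> (u, v) + \<kappa> (v, u) = 1"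
      "\<And>a b c d. (a, b) \<in> parcs H \<Longrightarrow> (b, c) \<in> parcs H \<Longrightarrow> (c, d) \<in> parcs H \<Longrightarrow>
        (d, a) \<in> parcs H \<Longrightarrow> \<kappa> (a, b) + \<kappa> (c, b) + \<kappa> (c, d) + \<kappa> (a, d) = 0"
    using Hom_K2_arc_parity[OF pair_sym_digraph_axioms G] by metis
  \<comment> \<open>The linear extension of \<kappa>; the arc set is finite, so this is a genuine
    sum.\<close>
  define K where "K x = (\<Sum>a\<in>parcs H. Poly_Mapping.lookup x a * \<kappa> a)" for x
  have K_add: "K (x + y) = K x + K y" for x y
    by (simp only: K_def lookup_add distrib_right sum.distrib)
  have K_basis: "K (basis_elt a) = \<kappa> a" if "a \<in> parcs H" for a
  proof -
    have "K (basis_elt a) = (\<Sum>b\<in>parcs H. if b = a then \<kappa> b else 0)"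
      unfolding K_def by (rule sum.cong) (auto simp: lookup_single when_def)
    then show ?thesis
      by (simp only: sum.delta[OF pair_finite_arcs] that if_True)
  qed
  have K_sum: "K (sum F A) = (\<Sum>i\<in>A. K (F i))" if "finite A" for F and A :: "nat set"
    using that
  proof induction
    case empty
    show ?case
      by (simp add: K_def)
  qed (simp only: sum.insert K_add not_False_eq_True)
  have carrier: "four_cycle_relators H \<subseteq> carrier (free_Z2_group (parcs H))"
  proof
    fix x assume "x \<in> four_cycle_relators H"
    then obtain a b c d where
      x: "x = basis_elt (a, b) + basis_elt (c, b) + basis_elt (c, d) + basis_elt (a, d)"
      and arcs: "(a, b) \<in> parcs H" "(c, b) \<in> parcs H" "(c, d) \<in> parcs H" "(a, d) \<in> parcs H"
      unfolding four_cycle_relators_def using sym by blast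
    show "x \<in> carrier (free_Z2_group (parcs H))"
      unfolding x free_Z2_group_def using arcs
      by (auto dest!: Poly_Mapping.keys_add[THEN subsetD] split: if_splits)
  qed
  have K_relation: "K x = 0" if "x \<in> relation_subgroup H" for x
  proof (rule additive_zero_on_generate[OF K_add carrier])
    show "x \<in> generate (free_Z2_group (parcs H)) (four_cycle_relators H)"
      using that by (simp add: relation_subgroup_def)
    fix y assume "y \<in> four_cycle_relators H"
    then obtain a b c d where
      y: "y = basis_elt (a, b) + basis_elt (c, b) + basis_elt (c, d) + basis_elt (a, d)"
      and arcs: "(a, b) \<in> parcs H" "(b, c) \<in> parcs H" "(c, d) \<in> parcs H" "(d, a) \<in> parcs H"
      unfolding four_cycle_relators_def by blast
    show "K y = 0"
      \<comment> \<open>A relator contains the second and fourth arcs of its 4-cycle reversed, hence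
        the use of symmetry.\<close>
      unfolding y K_add K_basis[OF arcs(1)] K_basis[OF sym[OF arcs(2)]] K_basis[OF arcs(3)]
        K_basis[OF sym[OF arcs(4)]] by (rule \<kappa>(2)[OF arcs])
  qed
  obtain n f where n: "n \<ge> 3" "odd n" and f: "f \<in> graph_hom (cycle_graph n) H"
    and \<sigma>: "sigma2 H n f = \<one>\<^bsub>G2 H\<^esub>"
    using assms(2) by blast
  have arc: "(f (j mod n), f (Suc j mod n)) \<in> parcs H" for j
  proof -
    have "(j mod n, Suc j mod n) \<in> parcs (cycle_graph n)"
      using n by (simp add: cycle_graph_def mod_Suc_eq)
    then show ?thesis
      using f unfolding graph_hom_def by blast
  qed
  let ?s = "\<Sum>i<n. basis_elt (f (2 * i mod n), f ((2 * i + 1) mod n))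
                + basis_elt (f ((2 * i + 2) mod n), f ((2 * i + 1) mod n))"
  \<comment> \<open>The coset contains its representative because 0 lies in the subgroup. The unit
    of the quotient is the subgroup itself, so the representative is a relation.\<close>
  have "0 + ?s \<in> sigma2 H n f"
    using generate.one[of "free_Z2_group (parcs H)" "four_cycle_relators H"]
    unfolding sigma2_def r_coset_def relation_subgroup_def by (auto simp: free_Z2_group_def)
  then have "?s \<in> relation_subgroup H"
    unfolding \<sigma> by (simp add: G2_def FactGroup_def)
  then have "K ?s = 0"
    by (rule K_relation)
  moreover have "K ?s = (\<Sum>i<n. \<kappa> (f (2 * i mod n), f ((2 * i + 1) mod n))
                + \<kappa> (f ((2 * i + 2) mod n), f ((2 * i + 1) mod n)))"
  proof -
    have "(f (2 * i mod n), f ((2 * i + 1) mod n)) \<in> parcs H"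
      "(f ((2 * i + 2) mod n), f ((2 * i + 1) mod n)) \<in> parcs H" for i
      using arc[of "2 * i"] sym[OF arc[of "2 * i + 1"]] by simp_all
    then show ?thesis
      by (simp only: K_sum[OF finite_lessThan] K_add K_basis)
  qed
  moreover have "\<dots> = 1"
    by (rule alternating_cycle_sum[OF n(2) \<kappa>(1)[OF arc]])
  ultimately show False
    by simp
qed

end
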